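(* Let $\phi$ be an analytic matrix function with convergence radius $\rho$. Suppose there exists $\bar\alpha\in(0,1)$ with $\bar\alpha<\rho$ such that for all $n\in\mathbb{N}$ and every $i\in[n]$ we have $\alpha_i\le\bar\alpha$, and suppose $p=p(n)\in(0,1)$ satisfies $p\gg\log(n)/n$. Then, when $G\sim\mathbb{G}(n,p)$, $$\lim_{n\to\infty}\left\|\mathbf{E}(\phi(H(G)))-\phi(\mathbf{E}(H(G)))\right\|_{\ast}=0.$$
   Context: Notation: $[n]=\{1,\dots,n\}$; $\log$ is the natural logarithm; for $h:\mathbb{N}\to\mathbb{R}_+$, $p\gg h$ means $p(n)/h(n)\to\infty$ as $n\to\infty$. For $M=(m_{ij})\in\mathbb{R}^{n\times n}$, $\|M\|_\ast=\max_{i\in[n]}\sum_{j=1}^n|m_{ij}|$ (the norm induced by the $\ell_\infty$-norm). $\mathbf{E}$ of a random matrix is the entrywise expectation. A function $\phi:\mathbb{R}\to\mathbb{R}$ is analytic with convergence radius $\rho$ if there is a sequence $(b_k)_{k\ge0}$ of reals such that $\phi(x)=\sum_{k=0}^\infty b_kx^k$ for every $x\in\mathbb{R}$ with $|x|<\rho$. The associated (analytic) matrix function is $\phi(X)=\sum_{k=0}^\infty b_kX^k$ for $X\in\mathbb{R}^{n\times n}$; the series converges whenever $\|X\|_\ast<\rho$. $\mathbb{G}(n,p)$ is the Erdős–Rényi undirected random graph model: a random simple undirected graph on node set $[n]$ in which each possible edge is present independently with probability $p=p(n)$. For each $n$, values $\alpha_i\in[0,1]$, $i\in[n]$, are given (they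 may depend on $n$; $\bar\alpha$ does not). For a graph $G$ on $[n]$ with adjacency matrix $A(G)$ and degrees $\deg(i)$, the matrix $H(G)\in\mathbb{R}^{n\times n}$ has entries $H_{ij}(G)=\alpha_iA_{ij}(G)/\deg(i)$ if $\deg(i)>0$, and $H_{ij}(G)=\alpha_i1_{\{i=j\}}$ if $\deg(i)=0$. *)

theory Defs
  imports "HOL-Probability.Product_PMF" "HOL-Library.Extended_Real" "Jordan_Normal_Form.Matrix"
begin

text \<open>
  The node set of a graph on \<open>n\<close> nodes is \<open>{..<n}\<close> (rather than \<open>{1..n}\<close>), matching the
  index range of matrices.  A simple undirected graph on these nodes is
  represented by its edge set, a subset of \<open>all_edges n\<close>.
\<close>

definition all_edges :: "nat \<Rightarrow> nat set set" where
  "all_edges n = {e. e \<subseteq> {..<n} \<and> card e = 2}"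

lemma finite_all_edges [simp]: "finite (all_edges n)"
  unfolding all_edges_def by (rule finite_subset[of _ "Pow {..<n}"]) auto

definition erdos_renyi :: "nat \<Rightarrow> real \<Rightarrow> nat set set pmf" where
  "erdos_renyi n q =
     map_pmf (\<lambda>f. {e \<in> all_edges n. f e})
       (Pi_pmf (all_edges n) False (\<lambda>_. bernoulli_pmf q))"

definition adj_mat :: "nat \<Rightarrow> nat set set \<Rightarrow> real mat" where
  "adj_mat n E = mat n n (\<lambda>(i, j). if {i, j} \<in> E then 1 else 0)"

definition degree_in :: "nat \<Rightarrow> nat set set \<Rightarrow> nat \<Rightarrow> nat" where
  "degree_in n E i = card {j. j < n \<and> {i, j} \<in> E}"

definition H_mat :: "nat \<Rightarrow> (nat \<Rightarrow> real) \<Rightarrow> nat set set \<Rightarrow> real mat" where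
  "H_mat n a E = mat n n (\<lambda>(i, j).
     if degree_in n E i > 0 then a i * adj_mat n E $$ (i, j) / real (degree_in n E i)
     else a i * (if i = j then 1 else 0))"

text \<open>The operator norm induced by the maximum norm; only meaningful if \<open>dim_row M > 0\<close>.\<close>

definition mat_norm :: "real mat \<Rightarrow> real" where
  "mat_norm M = Max ((\<lambda>i. \<Sum>j<dim_col M. \<bar>M $$ (i, j)\<bar>) ` {..<dim_row M})"

definition expectation_mat :: "nat \<Rightarrow> 'a pmf \<Rightarrow> ('a \<Rightarrow> real mat) \<Rightarrow> real mat" where
  "expectation_mat n P M =
     mat n n (\<lambda>(i, j). measure_pmf.expectation P (\<lambda>\<omega>. M \<omega> $$ (i, j)))"

text \<open>
  As usual for ``analytic with convergence radius \<open>\<rho>\<close>'', the radius is not required to be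
  maximal; \<open>\<rho> = \<infinity>\<close> is allowed.  For \<open>\<rho> > 0\<close> the coefficients \<open>b\<close> are determined by \<open>\<phi>\<close>.
\<close>

definition analytic_with_coeffs :: "(real \<Rightarrow> real) \<Rightarrow> ereal \<Rightarrow> (nat \<Rightarrow> real) \<Rightarrow> bool" where
  "analytic_with_coeffs \<phi> \<rho> b \<longleftrightarrow>
     (\<forall>x. ereal \<bar>x\<bar> < \<rho> \<longrightarrow> (\<lambda>k. b k * x ^ k) sums \<phi> x)"

text \<open>
  The matrix power series for a square matrix \<open>X\<close>, summed entrywise; the value is meaningful
  whenever the entries converge, in particular if \<open>mat_norm X < \<rho>\<close>.
\<close>

definition matrix_function :: "(nat \<Rightarrow> real) \<Rightarrow> real mat \<Rightarrow> real mat" where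
  "matrix_function b X =
     mat (dim_row X) (dim_row X) (\<lambda>(i, j). \<Sum>k. b k * (X ^\<^sub>m k) $$ (i, j))"

end

theory Submission
  imports Defs
begin

text \<open>
  Write \<open>H = diag(\<alpha>) P\<close> with \<open>P\<close> the random walk matrix of the graph, and let \<open>U\<close> be the walk
  matrix of the complete graph.  For a fixed walk \<open>w\<close> of length \<open>k\<close>, the probability that the
  random walk follows \<open>w\<close> is at least \<open>1(w \<subseteq> G) \<Prod> 1 / deg\<close>; replacing the product by its tangent
  plane makes the expectation computable and gives \<open>E P_w \<ge> r_k U_w\<close>, where
  \<open>r_k = ((n-1)p / ((n-1)p + k))^k\<close>.  Both \<open>E P_w\<close> and \<open>U_w\<close> sum to 1 over all walks from a given
  node, so this one-sided bound already forces their \<open>\<ell>\<^sub>1\<close>-distance to be at most \<open>2(1 - r_k)\<close>,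
  and no concentration of degrees is involved.  The same applies to \<open>E P\<close> in place of \<open>P\<close>.
  The factors \<open>\<alpha>\<close> contribute at most \<open>\<alpha>bar^k\<close> to each walk, so the theorem follows from
  Tannery's theorem.
\<close>

subsection \<open>Walks and powers of matrices\<close>

text \<open>The list holds the nodes after the start, so its length is the number of steps. The
  start \<open>i\<close> is passed separately, and the endpoint is \<open>last (i # xs)\<close>,
  which also covers the empty walk.\<close>

definition walks :: "nat \<Rightarrow> nat \<Rightarrow> nat list set" where
  "walks n k = {xs. set xs \<subseteq> {..<n} \<and> length xs = k}"

fun walk_weight :: "(nat \<Rightarrow> nat \<Rightarrow> real) \<Rightarrow> nat \<Rightarrow> nat list \<Rightarrow> real" where
  "walk_weight X i [] = 1"
| "walk_weight X i (x # xs) = X i x * walk_weight X x xs"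

text \<open>A set, so that an edge traversed several times counts once, as it does in the
  probability that all edges of the walk are present.\<close>

fun walk_edges :: "nat \<Rightarrow> nat list \<Rightarrow> nat set set" where
  "walk_edges i [] = {}"
| "walk_edges i (x # xs) = insert {i, x} (walk_edges x xs)"

lemma walks_0 [simp]: "walks n 0 = {[]}"
  by (auto simp: walks_def)

lemma finite_walks [simp]: "finite (walks n k)"
  unfolding walks_def by (rule finite_lists_length_eq) simp

lemma sum_walks_Suc:
  "(\<Sum>xs\<in>walks n (Suc k). f xs) = (\<Sum>x<n. \<Sum>xs\<in>walks n k. f (x # xs))"
proof -
  have "walks n (Suc k) = (\<lambda>(x, xs). x # xs) ` ({..<n} \<times> walks n k)"
    by (auto simp: walks_def length_Suc_conv image_iff)
  then have "(\<Sum>xs\<in>walks n (Suc k). f xs) = (\<Sum>(x, xs)\<in>{..<n} \<times> walks n k. f (x # xs))"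
    by (simp add: sum.reindex inj_on_def split_def)
  then show ?thesis
    by (simp add: sum.cartesian_product)
qed

text \<open>Powers unfold on the right, whereas walks are built from the front.\<close>

lemma pow_mat_Suc_left:
  fixes X :: "real mat"
  assumes "X \<in> carrier_mat n n"
  shows "X ^\<^sub>m Suc k = X * X ^\<^sub>m k"
proof (induction k)
  case 0
  show ?case using assms by simp
next
  case (Suc k)
  have "X ^\<^sub>m Suc (Suc k) = X * X ^\<^sub>m k * X"
    using Suc by simp
  also have "\<dots> = X * (X ^\<^sub>m k * X)"
    using assms by (intro assoc_mult_mat) auto
  finally show ?case by simp
qed

text \<open>Induction on the first step. The weight is a plain function \<open>W\<close>, so that a
  row factor can later be split off without matrix algebra.\<close>

lemma pow_mat_eq_sum_walks:
  fixes X :: "real mat"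
  assumes "X \<in> carrier_mat n n" "i < n" "j < n"
    and "\<And>i j. i < n \<Longrightarrow> j < n \<Longrightarrow> X $$ (i, j) = W i j"
  shows "(X ^\<^sub>m k) $$ (i, j) =
    (\<Sum>xs\<in>walks n k. if last (i # xs) = j then walk_weight W i xs else 0)"
  using assms(2)
proof (induction k arbitrary: i)
  case 0
  then show ?case using assms by auto
next
  case (Suc k)
  have "(X ^\<^sub>m Suc k) $$ (i, j) = (\<Sum>x<n. X $$ (i, x) * (X ^\<^sub>m k) $$ (x, j))"
    unfolding pow_mat_Suc_left[OF assms(1)] using assms Suc.prems
    by (simp add: scalar_prod_def lessThan_atLeast0)
  also have "\<dots> = (\<Sum>x<n. W i x *
      (\<Sum>xs\<in>walks n k. if last (x # xs) = j then walk_weight W x xs else 0))"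
    using Suc assms by (intro sum.cong) auto
  also have "\<dots> = (\<Sum>xs\<in>walks n (Suc k). if last (i # xs) = j then walk_weight W i xs else 0)"
    unfolding sum_walks_Suc sum_distrib_left by (intro sum.cong) auto
  finally show ?case .
qed

text \<open>Each walk has one endpoint, so it is counted at most once; the inequality avoids
  checking that the endpoint lies below \<open>n\<close>.\<close>

lemma sum_endpoint_le:
  fixes f :: "nat list \<Rightarrow> real"
  assumes "\<And>xs. xs \<in> walks n k \<Longrightarrow> 0 \<le> f xs"
  shows "(\<Sum>j<n. \<Sum>xs\<in>walks n k. if last (i # xs) = j then f xs else 0) \<le> (\<Sum>xs\<in>walks n k. f xs)"
proof -
  have "(\<Sum>j<n. \<Sum>xs\<in>walks n k. if last (i # xs) = j then f xs else 0) =
      (\<Sum>xs\<in>walks n k. \<Sum>j<n. if last (i # xs) = j then f xs else 0)"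
    by (rule sum.swap)
  also have "\<dots> \<le> (\<Sum>xs\<in>walks n k. f xs)"
  proof (rule sum_mono)
    fix xs assume "xs \<in> walks n k"
    then show "(\<Sum>j<n. if last (i # xs) = j then f xs else 0) \<le> f xs"
      using assms by (simp only: sum.delta' finite_lessThan) auto
  qed
  finally show ?thesis .
qed

section \<open>Total mass, comparison and row scaling of walk weights\<close>

lemma sum_walk_weight_stochastic:
  assumes "\<And>i. i < n \<Longrightarrow> (\<Sum>j<n. W i j) = 1" and "i < n"
  shows "(\<Sum>xs\<in>walks n k. walk_weight W i xs) = 1"
  using assms(2)
proof (induction k arbitrary: i)
  case (Suc k)
  then show ?case
    using assms(1) by (simp add: sum_walks_Suc flip: sum_distrib_left)
qed simp

lemma walk_weight_nonneg:
  assumes "\<And>i j. i < n \<Longrightarrow> j < n \<Longrightarrow> 0 \<le> W i j" "i < n" "set xs \<subseteq> {..<n}"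
  shows "0 \<le> walk_weight W i xs"
  using assms(2,3) by (induction xs arbitrary: i) (auto simp: assms(1))

text \<open>Every step loses one factor \<open>t\<close>. This turns an entrywise lower bound for
  the mean walk matrix into one for its walks.\<close>

lemma walk_weight_mono_factor:
  assumes "\<And>i j. i < n \<Longrightarrow> j < n \<Longrightarrow> t * V i j \<le> W i j"
    and "\<And>i j. i < n \<Longrightarrow> j < n \<Longrightarrow> 0 \<le> V i j" and "0 \<le> t" "i < n" "set xs \<subseteq> {..<n}"
  shows "t ^ length xs * walk_weight V i xs \<le> walk_weight W i xs"
  using assms(4,5)
proof (induction xs arbitrary: i)
  case (Cons x xs)
  have "(t * V i x) * (t ^ length xs * walk_weight V x xs) \<le> W i x * walk_weight W x xs"
  proof (rule mult_mono)
    have "0 \<le> t * V i x" using assms Cons.prems by auto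
    also show "t * V i x \<le> W i x" using assms Cons.prems by auto
    finally show "0 \<le> W i x" .
    show "0 \<le> t ^ length xs * walk_weight V x xs"
      using assms Cons.prems by (intro mult_nonneg_nonneg walk_weight_nonneg[of n]) auto
  qed (use Cons in auto)
  then show ?case by (simp add: mult_ac)
qed simp

text \<open>Each node that is left contributes its row factor, hence \<open>butlast\<close>. The
  prefactor depends on the walk but not on the matrix \<open>W\<close>, so it can be taken out of
  expectations over the graph.\<close>

lemma walk_weight_scale_rows:
  "walk_weight (\<lambda>i j. a i * W i j) i xs = prod_list (map a (butlast (i # xs))) * walk_weight W i xs"
  by (induction xs arbitrary: i) auto

lemma prod_list_map_bounds:
  fixes a :: "nat \<Rightarrow> real"
  assumes "\<And>i. i \<in> set vs \<Longrightarrow> 0 \<le> a i \<and> a i \<le> c"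
  shows "0 \<le> prod_list (map a vs) \<and> prod_list (map a vs) \<le> c ^ length vs"
  using assms
proof (induction vs)
  case (Cons v vs)
  moreover have "0 \<le> c" using Cons.prems[of v] by auto
  ultimately show ?case by (auto intro!: mult_mono)
qed simp

lemma set_butlast_walk: "i < n \<Longrightarrow> xs \<in> walks n k \<Longrightarrow> set (butlast (i # xs)) \<subseteq> {..<n}"
  by (auto simp: walks_def dest!: in_set_butlastD split: if_splits)

section \<open>Two elementary inequalities: one-sided domination and the tangent plane\<close>

text \<open>The excess of \<open>g\<close> over \<open>f\<close> is at most
  \<open>(1 - t) * g\<close> pointwise, and with equal total masses the positive and negative parts
  of \<open>f - g\<close> have equal sums.\<close>

lemma sum_abs_diff_le_of_domination:
  fixes f g :: "'a \<Rightarrow> real"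
  assumes "sum f A = 1" "sum g A = 1"
    and "\<And>x. x \<in> A \<Longrightarrow> t * g x \<le> f x" "\<And>x. x \<in> A \<Longrightarrow> 0 \<le> g x" "t \<le> 1"
  shows "(\<Sum>x\<in>A. \<bar>f x - g x\<bar>) \<le> 2 * (1 - t)"
proof -
  have "(\<Sum>x\<in>A. \<bar>f x - g x\<bar>) \<le> (\<Sum>x\<in>A. (f x - g x) + 2 * (1 - t) * g x)"
  proof (rule sum_mono)
    fix x assume "x \<in> A"
    then have "t * g x \<le> f x" "0 \<le> (1 - t) * g x" using assms by auto
    then show "\<bar>f x - g x\<bar> \<le> (f x - g x) + 2 * (1 - t) * g x"
      by (auto simp: abs_if algebra_simps)
  qed
  also have "\<dots> = 2 * (1 - t)"
    using assms(1,2) by (simp add: sum.distrib sum_subtractf flip: sum_distrib_left)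
  finally show ?thesis .
qed

text \<open>The product is \<open>exp\<close> of minus the sum of the logarithms;
  \<open>ln y \<le> y - 1\<close> and \<open>1 + x \<le> exp x\<close> give its tangent plane at all
  \<open>y v = 1\<close>. A list is used because a walk may revisit nodes.\<close>

lemma prod_inverse_ge_tangent:
  fixes y :: "'a \<Rightarrow> real"
  assumes "\<And>v. v \<in> set vs \<Longrightarrow> 0 < y v"
  shows "1 + (\<Sum>v\<leftarrow>vs. 1 - y v) \<le> (\<Prod>v\<leftarrow>vs. 1 / y v)"
proof -
  have "(\<Sum>v\<leftarrow>vs. 1 - y v) \<le> (\<Sum>v\<leftarrow>vs. - ln (y v))"
  proof (rule sum_list_mono)
    fix v assume "v \<in> set vs"
    then show "1 - y v \<le> - ln (y v)"
      using ln_le_minus_one[of "y v"] assms by simp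
  qed
  then have "1 + (\<Sum>v\<leftarrow>vs. 1 - y v) \<le> exp (\<Sum>v\<leftarrow>vs. - ln (y v))"
    using exp_ge_add_one_self[of "\<Sum>v\<leftarrow>vs. - ln (y v)"] by linarith
  also have "\<dots> = (\<Prod>v\<leftarrow>vs. 1 / y v)"
    using assms by (induction vs) (auto simp: exp_add exp_diff exp_minus divide_inverse)
  finally show ?thesis .
qed

subsection \<open>Random walks on Erdos--Renyi graphs\<close>

lemma finite_set_erdos_renyi [simp]: "finite (set_pmf (erdos_renyi n q))"
proof (rule finite_subset)
  show "set_pmf (erdos_renyi n q) \<subseteq> Pow (all_edges n)"
    by (auto simp: erdos_renyi_def)
qed simp

lemma integrable_erdos_renyi [simp]:
  fixes f :: "_ \<Rightarrow> real"
  shows "integrable (measure_pmf (erdos_renyi n q)) f"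
  by (rule integrable_measure_pmf_finite) simp

lemma expectation_erdos_renyi_superset:
  assumes "F \<subseteq> all_edges n" "0 \<le> q" "q \<le> 1"
  shows "measure_pmf.expectation (erdos_renyi n q) (\<lambda>E. of_bool (F \<subseteq> E)) = q ^ card F"
proof -
  \<comment> \<open>Factors 1 pad the product to all possible edges, so that the independence of the
    coordinates of \<open>Pi_pmf\<close> applies.\<close>
  have "measure_pmf.expectation (erdos_renyi n q) (\<lambda>E. of_bool (F \<subseteq> E)) =
      measure_pmf.expectation (Pi_pmf (all_edges n) False (\<lambda>_. bernoulli_pmf q))
        (\<lambda>f. \<Prod>e\<in>all_edges n. if e \<in> F then of_bool (f e) else 1 :: real)"
    unfolding erdos_renyi_def integral_map_pmf
  proof (rule Bochner_Integration.integral_cong[OF refl])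
    fix f :: "nat set \<Rightarrow> bool"
    have "(\<Prod>e\<in>all_edges n. if e \<in> F then of_bool (f e) else 1) = (\<Prod>e\<in>F. of_bool (f e) :: real)"
      using assms(1) by (intro prod.mono_neutral_cong_right) auto
    also have "\<dots> = of_bool (\<forall>e\<in>F. f e)"
      using finite_subset[OF assms(1) finite_all_edges] by (induction F rule: infinite_finite_induct) auto
    finally show "of_bool (F \<subseteq> {e \<in> all_edges n. f e}) =
        (\<Prod>e\<in>all_edges n. if e \<in> F then of_bool (f e) else 1 :: real)"
      using assms(1) by (auto simp: subset_iff)
  qed
  also have "\<dots> = (\<Prod>e\<in>all_edges n. measure_pmf.expectation (bernoulli_pmf q)
      (\<lambda>v. if e \<in> F then of_bool v else 1))"
    by (rule expectation_prod_Pi_pmf[where f = "\<lambda>e v. if e \<in> F then of_bool v else 1"])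
      (auto intro: integrable_measure_pmf_finite)
  also have "\<dots> = (\<Prod>e\<in>F. q)"
    using assms by (intro prod.mono_neutral_cong_right) auto
  finally show ?thesis by simp
qed

lemma set_pmf_erdos_renyi_subset:
  assumes "E \<in> set_pmf (erdos_renyi n q)"
  shows "E \<subseteq> all_edges n"
  using assms by (auto simp: erdos_renyi_def)

lemma pair_in_all_edges: "{u, v} \<in> all_edges n \<longleftrightarrow> u < n \<and> v < n \<and> u \<noteq> v"
  by (auto simp: all_edges_def card_2_iff doubleton_eq_iff)

text \<open>Given that \<open>F\<close> is present, a pair at \<open>v\<close> outside
  \<open>F\<close> is an edge with probability \<open>q\<close>, and at most \<open>card F\<close>
  neighbours come from \<open>F\<close> itself, since \<open>u\<close> is determined by
  \<open>{v, u}\<close>.\<close>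

lemma expectation_superset_degree_le:
  assumes "F \<subseteq> all_edges n" "0 \<le> q" "q \<le> 1" "v < n"
  shows "measure_pmf.expectation (erdos_renyi n q) (\<lambda>E. of_bool (F \<subseteq> E) * real (degree_in n E v))
    \<le> q ^ card F * (real (n - 1) * q + real (card F))"
proof -
  have finF: "finite F" using assms(1) by (rule finite_subset) simp
  let ?P = "measure_pmf (erdos_renyi n q)"
  let ?S = "{u. u < n \<and> {v, u} \<in> F}"
  have deg: "real (degree_in n E v) = (\<Sum>u<n. of_bool ({v, u} \<in> E))" for E
    by (simp add: degree_in_def Int_def conj_commute)
  have card: "card ?S \<le> card F"
  proof (rule card_inj_on_le[of "\<lambda>u. {v, u}"])
    show "inj_on (\<lambda>u. {v, u}) ?S" by (auto simp: inj_on_def doubleton_eq_iff)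
  qed (use finF in auto)
  have "(\<integral>E. of_bool (F \<subseteq> E) * real (degree_in n E v) \<partial>?P) =
      (\<integral>E. (\<Sum>u<n. of_bool (insert {v, u} F \<subseteq> E)) \<partial>?P)"
    unfolding deg sum_distrib_left by (intro Bochner_Integration.integral_cong sum.cong) auto
  also have "\<dots> = (\<Sum>u<n. \<integral>E. of_bool (insert {v, u} F \<subseteq> E) \<partial>?P)"
    by (rule Bochner_Integration.integral_sum) simp
  also have "\<dots> \<le> (\<Sum>u<n. q ^ card F * (of_bool (u \<noteq> v) * q + of_bool ({v, u} \<in> F)))"
  proof (rule sum_mono)
    fix u assume "u \<in> {..<n}"
    then have u: "u < n" by simp
    show "(\<integral>E. of_bool (insert {v, u} F \<subseteq> E) \<partial>?P)
        \<le> q ^ card F * (of_bool (u \<noteq> v) * q + of_bool ({v, u} \<in> F))"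
    proof (cases "u = v")
      case True
      \<comment> \<open>\<open>{v, v}\<close> is a singleton, so it belongs to no edge set in the
        support of the model.\<close>
      have "(\<integral>E. of_bool (insert {v, u} F \<subseteq> E) \<partial>?P) = (\<integral>E. (0 :: real) \<partial>?P)"
      proof (rule integral_cong_AE)
        show "AE E in ?P. of_bool (insert {v, u} F \<subseteq> E) = (0 :: real)"
          unfolding AE_measure_pmf_iff
        proof
          fix E assume "E \<in> set_pmf (erdos_renyi n q)"
          from set_pmf_erdos_renyi_subset[OF this] show "of_bool (insert {v, u} F \<subseteq> E) = (0 :: real)"
            using True pair_in_all_edges[of v v n] by auto
        qed
      qed auto
      then show ?thesis using assms(2) by (simp add: True)
    next
      case False
      then have "(\<integral>E. of_bool (insert {v, u} F \<subseteq> E) \<partial>?P) = q ^ card (insert {v, u} F)"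
        using assms u by (intro expectation_erdos_renyi_superset) (auto simp: pair_in_all_edges)
      then show ?thesis
        using False finF assms(2) by (auto simp: card_insert_if algebra_simps)
    qed
  qed
  also have "\<dots> = q ^ card F * ((\<Sum>u<n. of_bool (u \<noteq> v)) * q + (\<Sum>u<n. of_bool ({v, u} \<in> F)))"
    by (simp only: sum_distrib_left[symmetric] sum.distrib sum_distrib_right[symmetric])
  also have "(\<Sum>u<n. of_bool (u \<noteq> v)) = real (n - 1)"
  proof -
    have "{..<n} \<inter> {u. u \<noteq> v} = {..<n} - {v}" by auto
    then show ?thesis using assms(4) by simp
  qed
  also have "(\<Sum>u<n. of_bool ({v, u} \<in> F)) = real (card ?S)"
    by (simp add: Int_def conj_commute)
  also have "q ^ card F * (real (n - 1) * q + real (card ?S)) \<le>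
      q ^ card F * (real (n - 1) * q + real (card F))"
    using card assms(2) by (intro mult_left_mono add_left_mono) auto
  finally show ?thesis by simp
qed

section \<open>Walk matrices of a graph and of the complete graph\<close>

text \<open>An isolated node stays put, as in \<open>H_mat\<close>; the rows therefore sum to 1 for
  every \<open>E\<close>.\<close>

definition random_walk :: "nat \<Rightarrow> nat set set \<Rightarrow> nat \<Rightarrow> nat \<Rightarrow> real" where
  "random_walk n E i j =
     (if degree_in n E i > 0 then of_bool ({i, j} \<in> E) / real (degree_in n E i) else of_bool (i = j))"

definition uniform_walk :: "nat \<Rightarrow> nat \<Rightarrow> nat \<Rightarrow> real" where
  "uniform_walk n i j = of_bool (i \<noteq> j) / real (n - 1)"

lemma random_walk_nonneg: "0 \<le> random_walk n E i j"
  by (simp add: random_walk_def)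

lemma sum_random_walk:
  assumes "i < n"
  shows "(\<Sum>j<n. random_walk n E i j) = 1"
proof (cases "degree_in n E i > 0")
  case True
  then have "(\<Sum>j<n. random_walk n E i j) = (\<Sum>j<n. of_bool ({i, j} \<in> E)) / real (degree_in n E i)"
    by (simp only: random_walk_def if_True sum_divide_distrib)
  also have "(\<Sum>j<n. of_bool ({i, j} \<in> E)) = real (degree_in n E i)"
    by (simp add: degree_in_def Int_def conj_commute)
  finally show ?thesis using True by simp
next
  case False
  have "{..<n} \<inter> {j. i = j} = {i}" using assms by auto
  with False show ?thesis by (simp add: random_walk_def)
qed

lemma uniform_walk_nonneg: "0 \<le> uniform_walk n i j"
  by (simp add: uniform_walk_def)

lemma sum_uniform_walk:
  assumes "i < n" "2 \<le> n"
  shows "(\<Sum>j<n. uniform_walk n i j) = 1"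
proof -
  have "{..<n} \<inter> {j. i \<noteq> j} = {..<n} - {i}" by auto
  then show ?thesis using assms by (simp add: uniform_walk_def flip: sum_divide_distrib)
qed

lemma H_mat_eq:
  "i < n \<Longrightarrow> j < n \<Longrightarrow> H_mat n a E $$ (i, j) = a i * random_walk n E i j"
  by (simp add: H_mat_def adj_mat_def random_walk_def)

text \<open>With all nodes below \<open>n\<close>, a step outside \<open>all_edges n\<close> can
  only be a loop, and the complete graph has none. For such walks the lower bound on the expected
  weight is trivial.\<close>

lemma uniform_walk_weight_eq_0:
  assumes "\<not> walk_edges i xs \<subseteq> all_edges n" "i < n" "set xs \<subseteq> {..<n}"
  shows "walk_weight (uniform_walk n) i xs = 0"
  using assms by (induction xs arbitrary: i) (auto simp: pair_in_all_edges uniform_walk_def)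

lemma uniform_walk_weight_le:
  "walk_weight (uniform_walk n) i xs \<le> (1 / real (n - 1)) ^ length xs"
proof (induction xs arbitrary: i)
  case (Cons x xs)
  then show ?case
    by (auto simp: uniform_walk_def divide_right_mono)
qed simp

lemma card_walk_edges: "finite (walk_edges i xs) \<and> card (walk_edges i xs) \<le> length xs"
  by (induction xs arbitrary: i) (auto simp: card_insert_if le_SucI)

text \<open>Every node that is left has its successor as a neighbour, so the default for degree 0
  never applies.\<close>

lemma random_walk_weight_eq:
  assumes "walk_edges i xs \<subseteq> E" "i < n" "set xs \<subseteq> {..<n}"
  shows "(\<forall>v\<in>set (butlast (i # xs)). 0 < degree_in n E v) \<and>
    walk_weight (random_walk n E) i xs = (\<Prod>v\<leftarrow>butlast (i # xs). 1 / real (degree_in n E v))"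
  using assms
proof (induction xs arbitrary: i)
  case (Cons x xs)
  have "x \<in> {j. j < n \<and> {i, j} \<in> E}" using Cons.prems by auto
  then have "0 < degree_in n E i"
    unfolding degree_in_def card_gt_0_iff by auto
  with Cons show ?case by (auto simp: random_walk_def)
qed simp

text \<open>
  The tangent plane is taken where all degrees equal \<open>c = (n-1)q + k\<close>, which bounds the expected
  degree of a node given that the at most \<open>k\<close> edges of the walk are present.
\<close>

lemma expectation_random_walk_weight_ge:
  assumes "0 < q" "q < 1" "2 \<le> n" "i < n" "xs \<in> walks n k"
  shows "(real (n - 1) * q / (real (n - 1) * q + real k)) ^ k * walk_weight (uniform_walk n) i xs
    \<le> measure_pmf.expectation (erdos_renyi n q) (\<lambda>E. walk_weight (random_walk n E) i xs)"
proof (cases "walk_edges i xs \<subseteq> all_edges n")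
  case False
  have xs: "set xs \<subseteq> {..<n}" using assms(5) by (auto simp: walks_def)
  then show ?thesis
    using uniform_walk_weight_eq_0[OF False] assms
    by (auto intro!: integral_nonneg_AE walk_weight_nonneg[of n] random_walk_nonneg)
next
  case True
  have xs: "set xs \<subseteq> {..<n}" "length xs = k" using assms(5) by (auto simp: walks_def)
  let ?P = "measure_pmf (erdos_renyi n q)"
  define F where "F = walk_edges i xs"
  define c where "c = real (n - 1) * q + real k"
  define vs where "vs = butlast (i # xs)"
  have vs: "set vs \<subseteq> {..<n}" "length vs = k"
    using set_butlast_walk[OF assms(4,5)] xs by (auto simp: vs_def)
  have cF: "card F \<le> k" using card_walk_edges[of i xs] xs by (simp add: F_def)
  have c: "0 < c" using assms by (auto simp: c_def intro!: add_pos_nonneg)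
  let ?T = "\<lambda>E. \<Sum>v\<leftarrow>vs. 1 - real (degree_in n E v) / c"
  \<comment> \<open>On \<open>F \<subseteq> E\<close> this is the tangent plane for the rescaled
    degrees \<open>degree_in n E v / c\<close>; otherwise the left side vanishes.\<close>
  have lower: "(1 / c) ^ k * (of_bool (F \<subseteq> E) + of_bool (F \<subseteq> E) * ?T E)
      \<le> walk_weight (random_walk n E) i xs" for E
  proof (cases "F \<subseteq> E")
    case True
    note w = random_walk_weight_eq[OF True[unfolded F_def] assms(4) xs(1), folded vs_def]
    have "(1 / c) ^ k * (1 + ?T E) \<le> (1 / c) ^ k * (\<Prod>v\<leftarrow>vs. 1 / (real (degree_in n E v) / c))"
      using w c by (intro mult_left_mono prod_inverse_ge_tangent) auto
    also have "\<dots> = (\<Prod>v\<leftarrow>vs. 1 / real (degree_in n E v))"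
      unfolding vs(2)[symmetric] using c by (induction vs) (auto simp: field_simps)
    finally show ?thesis using w True by simp
  next
    case False
    then show ?thesis
      using assms(4) xs by (auto intro!: walk_weight_nonneg[of n] random_walk_nonneg)
  qed
  have pF: "(\<integral>E. of_bool (F \<subseteq> E) \<partial>?P) = q ^ card F"
    using True assms by (intro expectation_erdos_renyi_superset) (auto simp: F_def)
  \<comment> \<open>The linear terms are treated one node at a time. Each has nonnegative mean on
    the event \<open>F \<subseteq> E\<close>, because the conditional mean degree is at most
    \<open>c\<close>; so only the constant term matters.\<close>
  have "0 \<le> (\<integral>E. of_bool (F \<subseteq> E) * (\<Sum>v\<leftarrow>ws. 1 - real (degree_in n E v) / c) \<partial>?P)"
    if "set ws \<subseteq> {..<n}" for ws
    using that
  proof (induction ws)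
    case (Cons v ws)
    let ?I = "\<integral>E. of_bool (F \<subseteq> E) * real (degree_in n E v) \<partial>?P"
    have "?I \<le> q ^ card F * (real (n - 1) * q + real (card F))"
      using True assms Cons.prems by (intro expectation_superset_degree_le) (auto simp: F_def)
    also have "\<dots> \<le> q ^ card F * c"
      using cF assms by (auto simp: c_def)
    finally have "?I / c \<le> q ^ card F" using c by (simp add: field_simps)
    moreover have "(\<integral>E. of_bool (F \<subseteq> E) * (\<Sum>v\<leftarrow>v # ws. 1 - real (degree_in n E v) / c) \<partial>?P) =
      (\<integral>E. (of_bool (F \<subseteq> E) - of_bool (F \<subseteq> E) * real (degree_in n E v) / c) +
        of_bool (F \<subseteq> E) * (\<Sum>v\<leftarrow>ws. 1 - real (degree_in n E v) / c) \<partial>?P)"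
      by (intro Bochner_Integration.integral_cong) (auto simp: algebra_simps)
    moreover have "\<dots> = (q ^ card F - ?I / c) +
        (\<integral>E. of_bool (F \<subseteq> E) * (\<Sum>v\<leftarrow>ws. 1 - real (degree_in n E v) / c) \<partial>?P)"
      by (simp add: pF)
    ultimately show ?case using Cons by simp
  qed simp
  from this[OF vs(1)] have T: "0 \<le> (\<integral>E. of_bool (F \<subseteq> E) * ?T E \<partial>?P)" .
  have "(real (n - 1) * q / c) ^ k * walk_weight (uniform_walk n) i xs
      \<le> (real (n - 1) * q / c) ^ k * (1 / real (n - 1)) ^ k"
    using uniform_walk_weight_le[of n i xs] xs c assms by (intro mult_left_mono) auto
  also have "\<dots> = (1 / c) ^ k * q ^ k"
    using assms c by (simp add: field_simps flip: power_mult_distrib)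
  \<comment> \<open>Repeated edges make \<open>card F\<close> smaller than \<open>k\<close>, which
    only helps as \<open>q < 1\<close>.\<close>
  also have "\<dots> \<le> (1 / c) ^ k * q ^ card F"
    using c cF assms by (intro mult_left_mono power_decreasing) auto
  also have "\<dots> \<le> (1 / c) ^ k * (q ^ card F + (\<integral>E. of_bool (F \<subseteq> E) * ?T E \<partial>?P))"
    using T c by (intro mult_left_mono) auto
  also have "\<dots> = (\<integral>E. (1 / c) ^ k * (of_bool (F \<subseteq> E) + of_bool (F \<subseteq> E) * ?T E) \<partial>?P)"
    by (simp add: pF)
  also have "\<dots> \<le> (\<integral>E. walk_weight (random_walk n E) i xs \<partial>?P)"
    using lower by (intro integral_mono) auto
  finally show ?thesis by (simp add: c_def)
qed


subsection \<open>Expected powers versus powers of the expectation\<close>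

definition walk_ratio :: "nat \<Rightarrow> real \<Rightarrow> nat \<Rightarrow> real" where
  "walk_ratio n q k = (real (n - 1) * q / (real (n - 1) * q + real k)) ^ k"

text \<open>Two distances to the complete-graph walk are added: one for the expected walk weights,
  one for the walk weights of the mean matrix, which lose the one-step ratio \<open>k\<close>
  times.\<close>

definition walk_error :: "nat \<Rightarrow> real \<Rightarrow> nat \<Rightarrow> real" where
  "walk_error n q k = 2 * (1 - walk_ratio n q k) + 2 * (1 - walk_ratio n q 1 ^ k)"

lemma walk_ratio_bounds:
  assumes "0 \<le> q"
  shows "0 \<le> walk_ratio n q k" "walk_ratio n q k \<le> 1"
proof -
  have *: "0 \<le> x / (x + real k) \<and> x / (x + real k) \<le> 1" if "0 \<le> x" for x
    using that by (auto simp: divide_simps)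
  show "0 \<le> walk_ratio n q k" "walk_ratio n q k \<le> 1"
    unfolding walk_ratio_def using *[of "real (n - 1) * q"] assms
    by (auto intro!: power_le_one zero_le_power)
qed

lemma walk_error_bounds:
  assumes "0 \<le> q"
  shows "0 \<le> walk_error n q k" "walk_error n q k \<le> 4"
proof -
  note r = walk_ratio_bounds[OF assms, of n]
  show "0 \<le> walk_error n q k" "walk_error n q k \<le> 4"
    using r(1)[of k] r(2)[of k] zero_le_power[OF r(1)[of 1], of k] power_le_one[OF r[of 1], of k]
    unfolding walk_error_def by auto
qed

lemma sum_abs_walk_weight_diff_le:
  assumes "0 < q" "q < 1" "2 \<le> n" "i < n"
  shows "(\<Sum>xs\<in>walks n k.
      \<bar>measure_pmf.expectation (erdos_renyi n q) (\<lambda>E. walk_weight (random_walk n E) i xs) -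
       walk_weight (\<lambda>i j. measure_pmf.expectation (erdos_renyi n q) (\<lambda>E. random_walk n E i j)) i xs\<bar>)
    \<le> walk_error n q k"
proof -
  let ?P = "measure_pmf (erdos_renyi n q)"
  define Q where "Q = (\<lambda>i j. \<integral>E. random_walk n E i j \<partial>?P)"
  define f where "f = (\<lambda>xs. \<integral>E. walk_weight (random_walk n E) i xs \<partial>?P)"
  define g where "g = walk_weight (uniform_walk n) i"
  define h where "h = walk_weight Q i"
  have sum_f: "sum f (walks n k) = 1"
  proof -
    have "sum f (walks n k) = (\<integral>E. (\<Sum>xs\<in>walks n k. walk_weight (random_walk n E) i xs) \<partial>?P)"
      unfolding f_def by (rule Bochner_Integration.integral_sum[symmetric]) simp
    then show ?thesis
      using assms(4) by (simp add: sum_walk_weight_stochastic sum_random_walk)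
  qed
  have sum_g: "sum g (walks n k) = 1"
    unfolding g_def using assms by (intro sum_walk_weight_stochastic sum_uniform_walk) auto
  have sum_Q: "(\<Sum>j<n. Q i j) = 1" if "i < n" for i
  proof -
    have "(\<Sum>j<n. Q i j) = (\<integral>E. (\<Sum>j<n. random_walk n E i j) \<partial>?P)"
      unfolding Q_def by (rule Bochner_Integration.integral_sum[symmetric]) simp
    then show ?thesis using that by (simp add: sum_random_walk)
  qed
  have sum_h: "sum h (walks n k) = 1"
    unfolding h_def using assms sum_Q by (intro sum_walk_weight_stochastic) auto
  have g_nonneg: "0 \<le> g xs" if "xs \<in> walks n k" for xs
    using that assms unfolding g_def walks_def
    by (intro walk_weight_nonneg[of n] uniform_walk_nonneg) auto
  have f_ge: "walk_ratio n q k * g xs \<le> f xs" if "xs \<in> walks n k" for xs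
    unfolding walk_ratio_def g_def f_def
    using assms that by (intro expectation_random_walk_weight_ge)
  \<comment> \<open>An entry of the mean matrix is the expected weight of a walk with one step, so
    the walk bound with \<open>k = 1\<close> applies.\<close>
  have Q_ge: "walk_ratio n q 1 * uniform_walk n i j \<le> Q i j" if "i < n" "j < n" for i j
    using expectation_random_walk_weight_ge[OF assms(1-3) that(1), of "[j]" 1] that
    by (simp add: walks_def walk_ratio_def Q_def)
  have h_ge: "walk_ratio n q 1 ^ k * g xs \<le> h xs" if "xs \<in> walks n k" for xs
    using walk_weight_mono_factor[of n "walk_ratio n q 1" "uniform_walk n" Q i xs] Q_ge that assms
    by (simp add: g_def h_def walks_def uniform_walk_nonneg walk_ratio_bounds)
  have "(\<Sum>xs\<in>walks n k. \<bar>f xs - h xs\<bar>) \<le> (\<Sum>xs\<in>walks n k. \<bar>f xs - g xs\<bar> + \<bar>h xs - g xs\<bar>)"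
    by (intro sum_mono) linarith
  also have "\<dots> = (\<Sum>xs\<in>walks n k. \<bar>f xs - g xs\<bar>) + (\<Sum>xs\<in>walks n k. \<bar>h xs - g xs\<bar>)"
    by (rule sum.distrib)
  also have "\<dots> \<le> 2 * (1 - walk_ratio n q k) + 2 * (1 - walk_ratio n q 1 ^ k)"
    using assms(1) sum_f sum_g sum_h f_ge g_nonneg h_ge
    by (intro add_mono sum_abs_diff_le_of_domination power_le_one walk_ratio_bounds) auto
  finally show ?thesis unfolding f_def h_def Q_def walk_error_def .
qed

text \<open>The walk weights of a stochastic matrix sum to 1, and the row factors contribute at most
  \<open>c ^ k\<close>. The bound holds for each fixed \<open>E\<close> and provides convergence of
  the matrix series.\<close>

lemma abs_pow_H_mat_le:
  assumes "i < n" "j < n" and a: "\<And>i. i < n \<Longrightarrow> 0 \<le> a i \<and> a i \<le> c"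
  shows "\<bar>(H_mat n a E ^\<^sub>m k) $$ (i, j)\<bar> \<le> c ^ k"
proof -
  have carrier: "H_mat n a E \<in> carrier_mat n n" by (simp add: H_mat_def)
  let ?w = "walk_weight (random_walk n E) i"
  have w: "0 \<le> ?w xs" if "xs \<in> walks n k" for xs
    using that assms by (intro walk_weight_nonneg[of n] random_walk_nonneg) (auto simp: walks_def)
  define A where "A = (\<lambda>xs. prod_list (map a (butlast (i # xs))))"
  have A: "0 \<le> A xs" "A xs \<le> c ^ k" if "xs \<in> walks n k" for xs
    using prod_list_map_bounds[of "butlast (i # xs)" a c] set_butlast_walk[OF assms(1) that] that a
    by (auto simp: A_def walks_def subset_iff)
  have "0 \<le> c" using a[OF assms(1)] by auto
  have "\<bar>(H_mat n a E ^\<^sub>m k) $$ (i, j)\<bar> = \<bar>\<Sum>xs\<in>walks n k. if last (i # xs) = j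
      then A xs * ?w xs else 0\<bar>"
    by (subst pow_mat_eq_sum_walks[OF carrier assms(1,2), where W = "\<lambda>i j. a i * random_walk n E i j"])
      (simp_all only: H_mat_eq walk_weight_scale_rows A_def)
  also have "\<dots> \<le> (\<Sum>xs\<in>walks n k. c ^ k * ?w xs)"
    using w A \<open>0 \<le> c\<close> by (intro order.trans[OF sum_abs] sum_mono) (auto simp: abs_mult intro!: mult_right_mono)
  also have "\<dots> = c ^ k"
    using assms(1) by (simp add: sum_walk_weight_stochastic sum_random_walk flip: sum_distrib_left)
  finally show ?thesis .
qed

text \<open>Both powers carry the same deterministic prefactor \<open>A xs\<close> on each walk, so
  the difference reduces to that of the unscaled weights \<open>f\<close> and
  \<open>h\<close>.\<close>

lemma sum_abs_expectation_pow_diff_le: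
  assumes "0 < q" "q < 1" "2 \<le> n" "i < n" and a: "\<And>i. i < n \<Longrightarrow> 0 \<le> a i \<and> a i \<le> c"
  shows "(\<Sum>j<n. \<bar>measure_pmf.expectation (erdos_renyi n q) (\<lambda>E. (H_mat n a E ^\<^sub>m k) $$ (i, j)) -
      (expectation_mat n (erdos_renyi n q) (H_mat n a) ^\<^sub>m k) $$ (i, j)\<bar>)
    \<le> c ^ k * walk_error n q k"
proof -
  let ?P = "measure_pmf (erdos_renyi n q)"
  define Q where "Q = (\<lambda>i j. \<integral>E. random_walk n E i j \<partial>?P)"
  define A where "A = (\<lambda>xs. prod_list (map a (butlast (i # xs))))"
  define f where "f = (\<lambda>xs. \<integral>E. walk_weight (random_walk n E) i xs \<partial>?P)"
  define h where "h = walk_weight Q i"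
  have A: "0 \<le> A xs" "A xs \<le> c ^ k" if "xs \<in> walks n k" for xs
    using prod_list_map_bounds[of "butlast (i # xs)" a c] set_butlast_walk[OF assms(4) that] that a
    by (auto simp: A_def walks_def subset_iff)
  have "0 \<le> c" using a[OF assms(4)] by auto
  have carrier: "H_mat n a E \<in> carrier_mat n n" for E by (simp add: H_mat_def)
  have carrier': "expectation_mat n (erdos_renyi n q) (H_mat n a) \<in> carrier_mat n n"
    by (simp add: expectation_mat_def)
  have EH: "expectation_mat n (erdos_renyi n q) (H_mat n a) $$ (i, j) = a i * Q i j"
    if "i < n" "j < n" for i j
    using that by (simp add: expectation_mat_def H_mat_eq Q_def)
  have E_pow: "(\<integral>E. (H_mat n a E ^\<^sub>m k) $$ (i, j) \<partial>?P) =
      (\<Sum>xs\<in>walks n k. if last (i # xs) = j then A xs * f xs else 0)" if "j < n" for j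
  proof -
    have "(H_mat n a E ^\<^sub>m k) $$ (i, j) = (\<Sum>xs\<in>walks n k.
        if last (i # xs) = j then A xs * walk_weight (random_walk n E) i xs else 0)" for E
      by (subst pow_mat_eq_sum_walks[OF carrier assms(4) that,
            where W = "\<lambda>i j. a i * random_walk n E i j"])
        (simp_all only: H_mat_eq walk_weight_scale_rows A_def)
    then have "(\<integral>E. (H_mat n a E ^\<^sub>m k) $$ (i, j) \<partial>?P) = (\<integral>E. (\<Sum>xs\<in>walks n k.
        if last (i # xs) = j then A xs * walk_weight (random_walk n E) i xs else 0) \<partial>?P)"
      by simp
    also have "\<dots> = (\<Sum>xs\<in>walks n k. \<integral>E.
        (if last (i # xs) = j then A xs * walk_weight (random_walk n E) i xs else 0) \<partial>?P)"
      by (rule Bochner_Integration.integral_sum) simp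
    also have "\<dots> = (\<Sum>xs\<in>walks n k. if last (i # xs) = j then A xs * f xs else 0)"
      by (intro sum.cong) (auto simp: f_def)
    finally show ?thesis .
  qed
  have pow_E: "(expectation_mat n (erdos_renyi n q) (H_mat n a) ^\<^sub>m k) $$ (i, j) =
      (\<Sum>xs\<in>walks n k. if last (i # xs) = j then A xs * h xs else 0)" if "j < n" for j
    by (subst pow_mat_eq_sum_walks[OF carrier' assms(4) that, where W = "\<lambda>i j. a i * Q i j"])
      (simp_all only: EH walk_weight_scale_rows A_def h_def)
  have "(\<Sum>j<n. \<bar>(\<integral>E. (H_mat n a E ^\<^sub>m k) $$ (i, j) \<partial>?P) -
      (expectation_mat n (erdos_renyi n q) (H_mat n a) ^\<^sub>m k) $$ (i, j)\<bar>)
    \<le> (\<Sum>j<n. \<Sum>xs\<in>walks n k. if last (i # xs) = j then c ^ k * \<bar>f xs - h xs\<bar> else 0)"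
  proof (rule sum_mono)
    fix j assume "j \<in> {..<n}"
    then have j: "j < n" by simp
    have "\<bar>(\<integral>E. (H_mat n a E ^\<^sub>m k) $$ (i, j) \<partial>?P) -
        (expectation_mat n (erdos_renyi n q) (H_mat n a) ^\<^sub>m k) $$ (i, j)\<bar> =
        \<bar>\<Sum>xs\<in>walks n k. if last (i # xs) = j then A xs * (f xs - h xs) else 0\<bar>"
      unfolding E_pow[OF j] pow_E[OF j] sum_subtractf[symmetric]
      by (intro arg_cong[where f = abs] sum.cong) (auto simp: algebra_simps)
    also have "\<dots> \<le> (\<Sum>xs\<in>walks n k. if last (i # xs) = j then c ^ k * \<bar>f xs - h xs\<bar> else 0)"
      using A by (intro order.trans[OF sum_abs] sum_mono) (auto simp: abs_mult intro!: mult_right_mono)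
    finally show "\<bar>(\<integral>E. (H_mat n a E ^\<^sub>m k) $$ (i, j) \<partial>?P) -
        (expectation_mat n (erdos_renyi n q) (H_mat n a) ^\<^sub>m k) $$ (i, j)\<bar>
      \<le> (\<Sum>xs\<in>walks n k. if last (i # xs) = j then c ^ k * \<bar>f xs - h xs\<bar> else 0)" .
  qed
  also have "\<dots> \<le> (\<Sum>xs\<in>walks n k. c ^ k * \<bar>f xs - h xs\<bar>)"
    using \<open>0 \<le> c\<close> by (intro sum_endpoint_le) simp
  also have "\<dots> = c ^ k * (\<Sum>xs\<in>walks n k. \<bar>f xs - h xs\<bar>)"
    by (rule sum_distrib_left[symmetric])
  also have "\<dots> \<le> c ^ k * walk_error n q k"
    unfolding f_def h_def Q_def
    using \<open>0 \<le> c\<close> assms by (intro mult_left_mono sum_abs_walk_weight_diff_le) auto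
  finally show ?thesis .
qed

section \<open>From powers to power series\<close>

text \<open>The expectation is a finite sum, so pointwise summability suffices for the
  exchange.\<close>

lemma expectation_suminf_finite_support:
  fixes f :: "'a \<Rightarrow> nat \<Rightarrow> real"
  assumes "finite (set_pmf M)" "\<And>x. summable (f x)"
  shows "summable (\<lambda>k. measure_pmf.expectation M (\<lambda>x. f x k))"
    and "measure_pmf.expectation M (\<lambda>x. \<Sum>k. f x k) = (\<Sum>k. measure_pmf.expectation M (\<lambda>x. f x k))"
proof -
  have E: "measure_pmf.expectation M g = (\<Sum>x\<in>set_pmf M. g x * pmf M x)" for g :: "'a \<Rightarrow> real"
    using assms(1) by (intro integral_measure_pmf_real) auto
  show "summable (\<lambda>k. measure_pmf.expectation M (\<lambda>x. f x k))"
    unfolding E using assms(2) by (intro summable_sum summable_mult2)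
  show "measure_pmf.expectation M (\<lambda>x. \<Sum>k. f x k) = (\<Sum>k. measure_pmf.expectation M (\<lambda>x. f x k))"
    unfolding E using assms(2) by (simp add: suminf_sum summable_mult2 flip: suminf_mult2)
qed

lemma mat_norm_expectation_diff_le:
  assumes "0 < q" "q < 1" "2 \<le> n" and a: "\<And>i. i < n \<Longrightarrow> 0 \<le> a i \<and> a i \<le> c"
    and b: "summable (\<lambda>k. \<bar>b k\<bar> * c ^ k)"
  defines "D \<equiv> expectation_mat n (erdos_renyi n q) (\<lambda>E. matrix_function b (H_mat n a E)) -
    matrix_function b (expectation_mat n (erdos_renyi n q) (H_mat n a))"
  shows "0 \<le> mat_norm D" "mat_norm D \<le> (\<Sum>k. \<bar>b k\<bar> * c ^ k * walk_error n q k)"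
proof -
  let ?P = "erdos_renyi n q"
  let ?H = "H_mat n a" and ?EH = "expectation_mat n (erdos_renyi n q) (H_mat n a)"
  have dim: "dim_row D = n" "dim_col D = n"
    by (auto simp: D_def matrix_function_def expectation_mat_def)
  have "0 \<le> c" using a[of 0] assms(3) by auto
  have err: "0 \<le> walk_error n q k" "walk_error n q k \<le> 4" for k
    using walk_error_bounds assms(1) by auto
  have sum_err: "summable (\<lambda>k. \<bar>b k\<bar> * c ^ k * walk_error n q k)"
  proof (rule summable_comparison_test'[OF summable_mult2[OF b, of 4]])
    show "norm (\<bar>b k\<bar> * c ^ k * walk_error n q k) \<le> \<bar>b k\<bar> * c ^ k * 4" for k
      using err[of k] \<open>0 \<le> c\<close> by (auto simp: abs_mult intro!: mult_left_mono)
  qed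
  have row: "(\<Sum>j<n. \<bar>D $$ (i, j)\<bar>) \<le> (\<Sum>k. \<bar>b k\<bar> * c ^ k * walk_error n q k)" if i: "i < n" for i
  proof -
    define d where "d = (\<lambda>j k. measure_pmf.expectation ?P (\<lambda>E. (?H E ^\<^sub>m k) $$ (i, j)) -
      (?EH ^\<^sub>m k) $$ (i, j))"
    have d: "(\<Sum>j<n. \<bar>d j k\<bar>) \<le> c ^ k * walk_error n q k" for k
      unfolding d_def using assms(1-3) i a by (intro sum_abs_expectation_pow_diff_le)
    have sum_bd: "summable (\<lambda>k. \<bar>b k * d j k\<bar>)" if "j < n" for j
    proof (rule summable_comparison_test'[OF sum_err])
      fix k
      have "\<bar>d j k\<bar> \<le> (\<Sum>j<n. \<bar>d j k\<bar>)"
        using that by (intro member_le_sum) auto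
      then have "\<bar>d j k\<bar> \<le> c ^ k * walk_error n q k" using d[of k] by linarith
      then show "norm \<bar>b k * d j k\<bar> \<le> \<bar>b k\<bar> * c ^ k * walk_error n q k"
        by (simp add: abs_mult mult.assoc mult_left_mono)
    qed
    have D: "D $$ (i, j) = (\<Sum>k. b k * d j k)" if j: "j < n" for j
    proof -
      have "summable (\<lambda>k. b k * (?H E ^\<^sub>m k) $$ (i, j))" for E
      proof (rule summable_comparison_test'[OF b])
        show "norm (b k * (?H E ^\<^sub>m k) $$ (i, j)) \<le> \<bar>b k\<bar> * c ^ k" for k
          using abs_pow_H_mat_le[OF i j a] by (simp add: abs_mult mult_left_mono)
      qed
      note E = expectation_suminf_finite_support[OF finite_set_erdos_renyi this]
      \<comment> \<open>Convergence at the mean matrix is inferred: its series is the averaged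
        series minus the series of differences, both already summable.\<close>
      have "summable (\<lambda>k. b k * measure_pmf.expectation ?P (\<lambda>E. (?H E ^\<^sub>m k) $$ (i, j)) - b k * d j k)"
        using E(1) summable_rabs_cancel[OF sum_bd[OF j]] by (intro summable_diff) simp_all
      then have EH: "summable (\<lambda>k. b k * (?EH ^\<^sub>m k) $$ (i, j))"
        by (simp add: d_def algebra_simps)
      have "D $$ (i, j) = measure_pmf.expectation ?P (\<lambda>E. \<Sum>k. b k * (?H E ^\<^sub>m k) $$ (i, j)) -
          (\<Sum>k. b k * (?EH ^\<^sub>m k) $$ (i, j))"
        using i j by (simp add: D_def matrix_function_def expectation_mat_def H_mat_def)
      also have "\<dots> = (\<Sum>k. measure_pmf.expectation ?P (\<lambda>E. b k * (?H E ^\<^sub>m k) $$ (i, j)) -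
          b k * (?EH ^\<^sub>m k) $$ (i, j))"
        unfolding E(2) by (rule suminf_diff[OF E(1) EH])
      finally show ?thesis by (simp add: d_def algebra_simps)
    qed
    have "(\<Sum>j<n. \<bar>D $$ (i, j)\<bar>) \<le> (\<Sum>j<n. \<Sum>k. \<bar>b k * d j k\<bar>)"
      using D sum_bd by (intro sum_mono) (auto intro!: summable_rabs)
    also have "\<dots> = (\<Sum>k. \<Sum>j<n. \<bar>b k * d j k\<bar>)"
      using sum_bd by (intro suminf_sum[symmetric]) auto
    also have "\<dots> \<le> (\<Sum>k. \<bar>b k\<bar> * c ^ k * walk_error n q k)"
    proof (rule suminf_le)
      show "(\<Sum>j<n. \<bar>b k * d j k\<bar>) \<le> \<bar>b k\<bar> * c ^ k * walk_error n q k" for k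
        using d[of k] by (simp add: abs_mult mult.assoc mult_left_mono flip: sum_distrib_left)
      show "summable (\<lambda>k. \<Sum>j<n. \<bar>b k * d j k\<bar>)"
        using sum_bd by (intro summable_sum) auto
    qed (rule sum_err)
    finally show ?thesis .
  qed
  have "0 \<le> (\<Sum>j<n. \<bar>D $$ (0, j)\<bar>)" by (intro sum_nonneg) auto
  also have "\<dots> \<le> mat_norm D"
    unfolding mat_norm_def dim using assms(3) by (intro Max_ge) auto
  finally show "0 \<le> mat_norm D" .
  show "mat_norm D \<le> (\<Sum>k. \<bar>b k\<bar> * c ^ k * walk_error n q k)"
    unfolding mat_norm_def dim using assms(3) row by (intro Max.boundedI) (auto simp: lessThan_empty_iff)
qed

section \<open>Asymptotics\<close>

lemma walk_ratio_tendsto_1: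
  assumes "filterlim (\<lambda>n. p n / (ln (real n) / real n)) at_top sequentially"
    and "\<And>n. n \<ge> 1 \<Longrightarrow> 0 < p n"
  shows "(\<lambda>n. walk_ratio n (p n) k) \<longlonglongrightarrow> 1"
proof -
  \<comment> \<open>The factor 1/2 pays for replacing \<open>n\<close> by \<open>n - 1\<close>, as
    \<open>n / 2 \<le> n - 1\<close>.\<close>
  have "filterlim (\<lambda>n. p n / (ln (real n) / real n) * (1 / 2)) at_top sequentially"
    by (rule filterlim_at_top_mult_tendsto_pos[OF tendsto_const _ assms(1)]) simp
  then have lim: "filterlim (\<lambda>n. real (n - 1) * p n) at_top sequentially"
  proof (rule filterlim_at_top_mono)
    show "eventually (\<lambda>n. p n / (ln (real n) / real n) * (1 / 2) \<le> real (n - 1) * p n) sequentially"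
      \<comment> \<open>From 3 on \<open>ln n \<ge> 1\<close>, because \<open>exp 1 \<le> 3\<close>;
        dividing by the logarithm then only decreases the quotient.\<close>
      using eventually_ge_at_top[of 3]
    proof eventually_elim
      case (elim n)
      have "exp 1 \<le> real n" using exp_le elim by linarith
      then have "1 \<le> ln (real n)" using elim by (simp add: ln_ge_iff)
      then have "p n / (ln (real n) / real n) * (1 / 2) \<le> p n * real n / 2"
        using assms(2)[of n] elim by (simp add: field_simps)
      also have "\<dots> \<le> real (n - 1) * p n"
        using assms(2)[of n] elim by (simp add: of_nat_diff field_simps)
      finally show ?case .
    qed
  qed
  have x: "1 / (1 + real k / x) = x / (x + real k)" if "0 < x" for x
    using that by (simp add: field_simps)
  have "(\<lambda>n. real k / (real (n - 1) * p n)) \<longlonglongrightarrow> 0"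
    by (rule tendsto_divide_0[OF tendsto_const filterlim_at_top_imp_at_infinity[OF lim]])
  then have "(\<lambda>n. (1 / (1 + real k / (real (n - 1) * p n))) ^ k) \<longlonglongrightarrow> (1 / (1 + 0)) ^ k"
    by (intro tendsto_intros) auto
  moreover have "eventually (\<lambda>n. (1 / (1 + real k / (real (n - 1) * p n))) ^ k = walk_ratio n (p n) k)
      sequentially"
    using eventually_ge_at_top[of 2]
  proof eventually_elim
    case (elim n)
    then have "0 < real (n - 1) * p n" using assms(2)[of n] by simp
    then show ?case
      unfolding walk_ratio_def by (intro arg_cong[where f = "\<lambda>x. x ^ k"]) (simp only: x)
  qed
  ultimately show ?thesis by (simp add: filterlim_cong)
qed

theorem theorem4p1:
  fixes \<phi> :: "real \<Rightarrow> real" and b :: "nat \<Rightarrow> real" and \<rho> :: ereal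
    and \<alpha> :: "nat \<Rightarrow> nat \<Rightarrow> real" and \<alpha>bar :: real and p :: "nat \<Rightarrow> real"
  assumes "analytic_with_coeffs \<phi> \<rho> b"
    and "0 < \<alpha>bar" and "\<alpha>bar < 1" and "ereal \<alpha>bar < \<rho>"
    and "\<And>n i. i < n \<Longrightarrow> \<alpha> n i \<in> {0..1}"
    and "\<And>n i. i < n \<Longrightarrow> \<alpha> n i \<le> \<alpha>bar"
    and "\<And>n. n \<ge> 1 \<Longrightarrow> 0 < p n \<and> p n < 1"
    and "filterlim (\<lambda>n. p n / (ln (real n) / real n)) at_top sequentially"
  shows "(\<lambda>n. mat_norm
            (expectation_mat n (erdos_renyi n (p n)) (\<lambda>E. matrix_function b (H_mat n (\<alpha> n) E))
             - matrix_function b (expectation_mat n (erdos_renyi n (p n)) (H_mat n (\<alpha> n)))))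
         \<longlonglongrightarrow> 0"
    (is "?N \<longlonglongrightarrow> 0")
proof -
  \<comment> \<open>Convergence at a point beyond \<alpha>bar gives absolute convergence at
    \<alpha>bar.\<close>
  obtain x where x: "\<alpha>bar < x" "ereal x < \<rho>"
    using ereal_dense2[OF assms(4)] by auto
  have "summable (\<lambda>k. b k * x ^ k)"
    using assms(1,2) x by (auto simp: analytic_with_coeffs_def sums_iff)
  from powser_insidea[OF this, of \<alpha>bar] have b: "summable (\<lambda>k. \<bar>b k\<bar> * \<alpha>bar ^ k)"
    using assms(2) x by (simp add: abs_mult power_abs)
  \<comment> \<open>The threshold 2 keeps \<open>n - 1\<close> positive in
    \<open>uniform_walk\<close> and the maximum in \<open>mat_norm\<close> over a nonempty
    set.\<close>
  have bounds: "0 \<le> ?N n \<and> ?N n \<le> (\<Sum>k. \<bar>b k\<bar> * \<alpha>bar ^ k * walk_error n (p n) k)" if "2 \<le> n" for n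
    using that assms(5-7) b
    by (intro conjI mat_norm_expectation_diff_le) auto
  have lim_ratio: "(\<lambda>n. walk_ratio n (p n) k) \<longlonglongrightarrow> 1" for k
    using assms(7,8) by (intro walk_ratio_tendsto_1) auto
  have error_lim: "(\<lambda>n. \<bar>b k\<bar> * \<alpha>bar ^ k * walk_error n (p n) k) \<longlonglongrightarrow> 0" for k
  proof -
    have "(\<lambda>n. \<bar>b k\<bar> * \<alpha>bar ^ k * walk_error n (p n) k) \<longlonglongrightarrow> \<bar>b k\<bar> * \<alpha>bar ^ k * (2 * (1 - 1) + 2 * (1 - 1 ^ k))"
      unfolding walk_error_def by (intro tendsto_intros lim_ratio)
    then show ?thesis by simp
  qed
  \<comment> \<open>The uniform bound 4 on \<open>walk_error\<close> yields a summable majorant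
    independent of \<open>n\<close>, which allows the limit to be taken termwise.\<close>
  have "eventually (\<lambda>(k, n). norm (\<bar>b k\<bar> * \<alpha>bar ^ k * walk_error n (p n) k) \<le> \<bar>b k\<bar> * \<alpha>bar ^ k * 4)
      (at_top \<times>\<^sub>F sequentially)"
  proof (rule eventually_prod_sequentially[THEN iffD2], intro exI allI impI, clarify)
    fix k n :: nat assume "1 \<le> n" "1 \<le> k"
    then have "0 \<le> p n" using assms(7)[of n] by simp
    then have "\<bar>walk_error n (p n) k\<bar> \<le> 4"
      using walk_error_bounds[of "p n" n k] by simp
    then show "norm (\<bar>b k\<bar> * \<alpha>bar ^ k * walk_error n (p n) k) \<le> \<bar>b k\<bar> * \<alpha>bar ^ k * 4"
      using assms(2) by (simp add: abs_mult mult_left_mono)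
  qed
  from tannerys_theorem[OF error_lim this summable_mult2[OF b]]
  have lim: "(\<lambda>n. \<Sum>k. \<bar>b k\<bar> * \<alpha>bar ^ k * walk_error n (p n) k) \<longlonglongrightarrow> 0"
    by simp
  have "eventually (\<lambda>n. norm (?N n) \<le> (\<Sum>k. \<bar>b k\<bar> * \<alpha>bar ^ k * walk_error n (p n) k)) sequentially"
    using eventually_ge_at_top[of 2]
  proof eventually_elim
    case (elim n)
    from bounds[OF this] show ?case by (simp only: real_norm_def abs_of_nonneg)
  qed
  from Lim_null_comparison[OF this lim] show ?thesis .
qed

end
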